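(* Let $$M_B=T\cdot\Sigma_B=\frac{1}{192}\left(\begin{array}{cccccc} 60&-6&-6&-6&-6&-36\\ -6&15&7&-9&-1&-6\\ -6&7&15&-1&-9&-6\\ -6&-9&-1&15&7&-6\\ -6&-1&-9&7&15&-6\\ -36&-6&-6&-6&-6&60 \end{array}\right)$$ be the ($T$-scaled) asymptotic covariance matrix of pattern frequencies of symmetric random walk. Then the vectors $\overline{\beta},\overline{\tau},\overline{\gamma},\overline{\delta}$ of the four pattern contrasts are, up to scalar multiples, exactly the eigenvectors of $M_B$ for its nonzero eigenvalues: these eigenvalues are $\frac12$ for $\overline{\beta}$, $\frac{3}{16}$ for $\overline{\tau}$, $\frac1{12}$ for $\overline{\gamma}$ and $\frac16$ for $\overline{\delta}$. The variances of the contrasts are $$T\,\mathrm{Var}\,\beta=1,\qquad T\,\mathrm{Var}\,\tau=\tfrac14,\qquad T\,\mathrm{Var}\,\gamma=\tfrac13,\qquad T\,\mathrm{Var}\,\delta=\tfrac23 .$$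
   Context: Rows and columns of the matrix and coordinates of $\mathbb{R}^6$ are indexed by the permutations $123,132,213,231,312,321$ in this order. The (row) vectors of the four pattern contrasts are $$\overline{\beta}=(1,0,0,0,0,-1),\quad \overline{\tau}=\left(\tfrac23,-\tfrac13,-\tfrac13,-\tfrac13,-\tfrac13,\tfrac23\right),$$ $$\overline{\gamma}=(0,-1,1,1,-1,0),\quad \overline{\delta}=(0,1,1,-1,-1,0).$$ $T$ is the length of the sample series. For a linear combination of pattern frequencies given by a row vector $x\in\mathbb{R}^6$, its $T$-scaled (asymptotic) variance is by definition $x M_B x'$, where $x'$ is the transpose; e.g. $T\,\mathrm{Var}\,\beta=\overline{\beta}M_B\overline{\beta}'$, and similarly for $\tau,\gamma,\delta$. *)

theory Defs
  imports Complex_Main "Jordan_Normal_Form.Char_Poly"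
begin

(* Positions 0, ..., 5 stand for the patterns 123, 132, 213, 231, 312, 321, in this order. *)

definition M_B :: "real mat" where
  "M_B = (1 / 192) \<cdot>\<^sub>m mat_of_rows_list 6
    [[ 60, -6, -6, -6, -6, -36],
     [ -6, 15,  7, -9, -1,  -6],
     [ -6,  7, 15, -1, -9,  -6],
     [ -6, -9, -1, 15,  7,  -6],
     [ -6, -1, -9,  7, 15,  -6],
     [-36, -6, -6, -6, -6,  60]]"

definition beta_bar :: "real vec" where
  "beta_bar = vec_of_list [1, 0, 0, 0, 0, -1]"

definition tau_bar :: "real vec" where
  "tau_bar = vec_of_list [2/3, -1/3, -1/3, -1/3, -1/3, 2/3]"

definition gamma_bar :: "real vec" where
  "gamma_bar = vec_of_list [0, -1, 1, 1, -1, 0]"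

definition delta_bar :: "real vec" where
  "delta_bar = vec_of_list [0, 1, 1, -1, -1, 0]"

(* The quadratic form x M_B x' of a row vector x. The matrix M_B is T times the asymptotic
   covariance matrix of the pattern frequencies, so the factor T is already included. *)
definition T_scaled_variance :: "real vec \<Rightarrow> real" where
  "T_scaled_variance x = x \<bullet> (M_B *\<^sub>v x)"

end

theory Submission
  imports Defs
begin

text \<open>
  The four contrasts are pairwise orthogonal, and \<open>M_B\<close> has the spectral decomposition
  \<open>M_B v = (\<Sum>w. \<lambda>\<^sub>w * (w \<bullet> v) / (w \<bullet> w) * w)\<close>, where \<open>w\<close> runs over the contrasts and \<open>\<lambda>\<^sub>w\<close> is
  the claimed eigenvalue (lemma \<open>M_B_spectral_decomposition\<close>). Everything else follows from
  this formula and the Gram matrix of the contrasts. Each \<open>w\<close> is an eigenvector for \<open>\<lambda>\<^sub>w\<close>, with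
  variance \<open>\<lambda>\<^sub>w * (w \<bullet> w)\<close>. Conversely, let \<open>M_B v = k v\<close> with \<open>k \<noteq> 0\<close> and \<open>v \<noteq> 0\<close>. Then \<open>v\<close>
  lies in the span of the contrasts, and pairing the equation with \<open>w\<close> gives
  \<open>k (w \<bullet> v) = \<lambda>\<^sub>w (w \<bullet> v)\<close>. The four numbers \<open>\<lambda>\<^sub>w\<close> are distinct, so at most one pairing \<open>w \<bullet> v\<close>
  is nonzero. It cannot happen that all of them vanish, since then \<open>v = 0\<close>. Hence \<open>v\<close> is a
  nonzero multiple of the one contrast \<open>w\<close> with \<open>k = \<lambda>\<^sub>w\<close>.
\<close>

lemmas contrasts_defs = beta_bar_def tau_bar_def gamma_bar_def delta_bar_def

lemma contrasts_dim [simp]: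
  "dim_vec beta_bar = 6" "dim_vec tau_bar = 6" "dim_vec gamma_bar = 6" "dim_vec delta_bar = 6"
  by (simp_all add: contrasts_defs)

lemma contrasts_carrier [simp]:
  "beta_bar \<in> carrier_vec 6" "tau_bar \<in> carrier_vec 6"
  "gamma_bar \<in> carrier_vec 6" "delta_bar \<in> carrier_vec 6"
  by (simp_all add: carrier_vecI)

lemma M_B_dim [simp]: "dim_row M_B = 6" "dim_col M_B = 6"
  by (simp_all add: M_B_def mat_of_rows_list_def)

lemma less_6_cases: "i < 6 \<longleftrightarrow> i = 0 \<or> i = 1 \<or> i = 2 \<or> i = 3 \<or> i = 4 \<or> i = (5::nat)"
  by auto

lemma scalar_prod_6:
  assumes "dim_vec w = 6"
  shows "v \<bullet> w = v $ 0 * w $ 0 + v $ 1 * w $ 1 + v $ 2 * w $ 2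
               + v $ 3 * w $ 3 + v $ 4 * w $ 4 + v $ 5 * (w $ 5 :: real)"
  using assms by (simp add: scalar_prod_def eval_nat_numeral)

lemma contrasts_entries:
  "beta_bar $ 0 = 1" "beta_bar $ Suc 0 = 0" "beta_bar $ 2 = 0"
  "beta_bar $ 3 = 0" "beta_bar $ 4 = 0" "beta_bar $ 5 = -1"
  "tau_bar $ 0 = 2/3" "tau_bar $ Suc 0 = -1/3" "tau_bar $ 2 = -1/3"
  "tau_bar $ 3 = -1/3" "tau_bar $ 4 = -1/3" "tau_bar $ 5 = 2/3"
  "gamma_bar $ 0 = 0" "gamma_bar $ Suc 0 = -1" "gamma_bar $ 2 = 1"
  "gamma_bar $ 3 = 1" "gamma_bar $ 4 = -1" "gamma_bar $ 5 = 0"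
  "delta_bar $ 0 = 0" "delta_bar $ Suc 0 = 1" "delta_bar $ 2 = 1"
  "delta_bar $ 3 = -1" "delta_bar $ 4 = -1" "delta_bar $ 5 = 0"
  unfolding contrasts_defs vec_of_list_index by simp_all

lemma contrasts_gram:
  "beta_bar \<bullet> beta_bar = 2" "tau_bar \<bullet> tau_bar = 4/3"
  "gamma_bar \<bullet> gamma_bar = 4" "delta_bar \<bullet> delta_bar = 4"
  "beta_bar \<bullet> tau_bar = 0" "beta_bar \<bullet> gamma_bar = 0" "beta_bar \<bullet> delta_bar = 0"
  "tau_bar \<bullet> beta_bar = 0" "tau_bar \<bullet> gamma_bar = 0" "tau_bar \<bullet> delta_bar = 0"
  "gamma_bar \<bullet> beta_bar = 0" "gamma_bar \<bullet> tau_bar = 0" "gamma_bar \<bullet> delta_bar = 0"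
  "delta_bar \<bullet> beta_bar = 0" "delta_bar \<bullet> tau_bar = 0" "delta_bar \<bullet> gamma_bar = 0"
  by (simp_all add: scalar_prod_6 contrasts_entries)

definition contrast_combination :: "real \<Rightarrow> real \<Rightarrow> real \<Rightarrow> real \<Rightarrow> real vec" where
  "contrast_combination a b c d =
     a \<cdot>\<^sub>v beta_bar + b \<cdot>\<^sub>v tau_bar + c \<cdot>\<^sub>v gamma_bar + d \<cdot>\<^sub>v delta_bar"

lemma contrast_combination_single:
  "contrast_combination a 0 0 0 = a \<cdot>\<^sub>v beta_bar" "contrast_combination 0 b 0 0 = b \<cdot>\<^sub>v tau_bar"
  "contrast_combination 0 0 c 0 = c \<cdot>\<^sub>v gamma_bar" "contrast_combination 0 0 0 d = d \<cdot>\<^sub>v delta_bar"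
  by (auto simp: contrast_combination_def)

lemma smult_contrast_combination:
  "r \<cdot>\<^sub>v contrast_combination a b c d = contrast_combination (r * a) (r * b) (r * c) (r * d)"
  by (auto simp: contrast_combination_def algebra_simps)

lemma scalar_prod_contrast_combination:
  "beta_bar \<bullet> contrast_combination a b c d = 2 * a"
  "tau_bar \<bullet> contrast_combination a b c d = 4/3 * b"
  "gamma_bar \<bullet> contrast_combination a b c d = 4 * c"
  "delta_bar \<bullet> contrast_combination a b c d = 4 * d"
  unfolding contrast_combination_def
  by (simp_all add: scalar_prod_add_distrib[of _ 6] contrasts_gram)

text \<open>
  Each coefficient is written as the eigenvalue divided by the squared norm of the contrast,
  times the pairing with \<open>v\<close>. Both sides are linear in \<open>v\<close>, so the identity is a comparison
  of the 36 entries of two matrices.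
\<close>

lemma M_B_spectral_decomposition:
  assumes v: "v \<in> carrier_vec 6"
  shows "M_B *\<^sub>v v = contrast_combination
           (1/2 / 2 * (beta_bar \<bullet> v)) (3/16 / (4/3) * (tau_bar \<bullet> v))
           (1/12 / 4 * (gamma_bar \<bullet> v)) (1/6 / 4 * (delta_bar \<bullet> v))"
    (is "_ = ?r")
proof (rule eq_vecI)
  have dim: "dim_vec v = 6" using v by simp
  show "dim_vec (M_B *\<^sub>v v) = dim_vec ?r"
    by (simp add: contrast_combination_def)
  fix i assume "i < dim_vec ?r"
  then have i: "i < 6"
    by (simp add: contrast_combination_def)
  then have "(M_B *\<^sub>v v) $ i = row M_B i \<bullet> v" by simp
  also have "\<dots> = ?r $ i"
    using i unfolding less_6_cases
    by (elim disjE; simp add: scalar_prod_6[OF dim] contrast_combination_def;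
        simp add: M_B_def mat_of_rows_list_def contrasts_entries field_simps)
  finally show "(M_B *\<^sub>v v) $ i = ?r $ i" .
qed

lemma M_B_contrasts:
  "M_B *\<^sub>v beta_bar = (1/2) \<cdot>\<^sub>v beta_bar" "M_B *\<^sub>v tau_bar = (3/16) \<cdot>\<^sub>v tau_bar"
  "M_B *\<^sub>v gamma_bar = (1/12) \<cdot>\<^sub>v gamma_bar" "M_B *\<^sub>v delta_bar = (1/6) \<cdot>\<^sub>v delta_bar"
  by (simp_all add: M_B_spectral_decomposition contrasts_gram contrast_combination_single)

lemma contrasts_nonzero:
  "beta_bar \<noteq> 0\<^sub>v 6" "tau_bar \<noteq> 0\<^sub>v 6" "gamma_bar \<noteq> 0\<^sub>v 6" "delta_bar \<noteq> 0\<^sub>v 6"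
  using contrasts_entries
  \<comment> \<open>Every contrast is nonzero at position 2 or at position 5.\<close>
  by (auto dest!: arg_cong[where f = "\<lambda>v. (v $ 2, v $ 5)"])

lemma eigenvector_smult:
  assumes A: "A \<in> carrier_mat n n" and ev: "eigenvector A w k" and c: "c \<noteq> (0 :: 'a :: field)"
  shows "eigenvector A (c \<cdot>\<^sub>v w) k"
proof -
  have w: "w \<in> carrier_vec n" "w \<noteq> 0\<^sub>v n" "A *\<^sub>v w = k \<cdot>\<^sub>v w"
    using A ev by (auto simp: eigenvector_def)
  have "c \<cdot>\<^sub>v w \<noteq> 0\<^sub>v n"
    using w(1,2) c by (auto simp: vec_eq_iff)
  then show ?thesis
    using A w mult_mat_vec[OF A w(1), of c]
    by (auto simp: eigenvector_def smult_smult_assoc mult.commute)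
qed

text \<open>
  Expand \<open>v\<close> in the contrasts. Comparing the coefficients of \<open>M_B v\<close> and \<open>k v\<close> leaves at most
  one of them nonzero, because the four eigenvalues are distinct.
\<close>

lemma M_B_eigenvector_cases:
  assumes "eigenvector M_B v k" and k: "k \<noteq> 0"
  obtains c where "c \<noteq> 0" "k = 1/2" "v = c \<cdot>\<^sub>v beta_bar"
  | c where "c \<noteq> 0" "k = 3/16" "v = c \<cdot>\<^sub>v tau_bar"
  | c where "c \<noteq> 0" "k = 1/12" "v = c \<cdot>\<^sub>v gamma_bar"
  | c where "c \<noteq> 0" "k = 1/6" "v = c \<cdot>\<^sub>v delta_bar"
proof -
  have v: "v \<in> carrier_vec 6" and nz: "v \<noteq> 0\<^sub>v 6" and eq: "M_B *\<^sub>v v = k \<cdot>\<^sub>v v"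
    using assms(1) by (auto simp: eigenvector_def)
  define s where "s = contrast_combination
    (1/2 / 2 * (beta_bar \<bullet> v)) (3/16 / (4/3) * (tau_bar \<bullet> v))
    (1/12 / 4 * (gamma_bar \<bullet> v)) (1/6 / 4 * (delta_bar \<bullet> v))"
  have "k \<cdot>\<^sub>v v = s"
    using M_B_spectral_decomposition[OF v] eq by (simp add: s_def)
  then have "(1/k) \<cdot>\<^sub>v s = (1/k * k) \<cdot>\<^sub>v v"
    by (metis smult_smult_assoc)
  then have "v = (1/k) \<cdot>\<^sub>v s"
    using k by simp
  \<comment> \<open>Since \<open>k \<noteq> 0\<close>, the vector lies in the image of \<open>M_B\<close>, the span of the contrasts.\<close>
  then obtain a b c d where v_eq: "v = contrast_combination a b c d"
    unfolding s_def smult_contrast_combination by blast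
  have comb: "contrast_combination (k * a) (k * b) (k * c) (k * d)
      = contrast_combination (1/2 * a) (3/16 * b) (1/12 * c) (1/6 * d)"
    using M_B_spectral_decomposition[OF v] eq
    by (simp add: v_eq smult_contrast_combination scalar_prod_contrast_combination)
  have coeffs: "a = 0 \<or> k = 1/2" "b = 0 \<or> k = 3/16" "c = 0 \<or> k = 1/12" "d = 0 \<or> k = 1/6"
    using arg_cong[OF comb, of "\<lambda>x. beta_bar \<bullet> x"] arg_cong[OF comb, of "\<lambda>x. tau_bar \<bullet> x"]
      arg_cong[OF comb, of "\<lambda>x. gamma_bar \<bullet> x"] arg_cong[OF comb, of "\<lambda>x. delta_bar \<bullet> x"]
    by (auto simp: scalar_prod_contrast_combination)
  have "a \<noteq> 0 \<or> b \<noteq> 0 \<or> c \<noteq> 0 \<or> d \<noteq> 0"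
    using nz v_eq contrast_combination_single(1)[of 0] by auto
  then consider "a \<noteq> 0" | "b \<noteq> 0" | "c \<noteq> 0" | "d \<noteq> 0" by blast
  then show thesis
  proof cases
    case 1
    then have "k = 1/2" "b = 0" "c = 0" "d = 0" using coeffs by auto
    then show ?thesis using 1 that(1)[of a] v_eq contrast_combination_single by simp
  next
    case 2
    then have "k = 3/16" "a = 0" "c = 0" "d = 0" using coeffs by auto
    then show ?thesis using 2 that(2)[of b] v_eq contrast_combination_single by simp
  next
    case 3
    then have "k = 1/12" "a = 0" "b = 0" "d = 0" using coeffs by auto
    then show ?thesis using 3 that(3)[of c] v_eq contrast_combination_single by simp
  next
    case 4
    then have "k = 1/6" "a = 0" "b = 0" "c = 0" using coeffs by auto
    then show ?thesis using 4 that(4)[of d] v_eq contrast_combination_single by simp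
  qed
qed

lemma contrasts_eigenvectors:
  "eigenvector M_B beta_bar (1/2)" "eigenvector M_B tau_bar (3/16)"
  "eigenvector M_B gamma_bar (1/12)" "eigenvector M_B delta_bar (1/6)"
  by (simp_all add: eigenvector_def M_B_contrasts contrasts_nonzero)

lemma M_B_nonzero_eigenvalues: "{k. eigenvalue M_B k \<and> k \<noteq> 0} = {1/2, 3/16, 1/12, 1/6}"
proof
  show "{k. eigenvalue M_B k \<and> k \<noteq> 0} \<subseteq> {1/2, 3/16, 1/12, 1/6}"
    by (auto simp: eigenvalue_def elim: M_B_eigenvector_cases)
  show "{1/2, 3/16, 1/12, 1/6} \<subseteq> {k. eigenvalue M_B k \<and> k \<noteq> 0}"
    using contrasts_eigenvectors by (auto simp: eigenvalue_def)
qed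

lemma M_B_nonzero_eigenvectors:
  "{v. \<exists>k. k \<noteq> 0 \<and> eigenvector M_B v k} =
   {c \<cdot>\<^sub>v w | c w. c \<noteq> 0 \<and> w \<in> {beta_bar, tau_bar, gamma_bar, delta_bar}}" (is "?L = ?R")
proof
  show "?L \<subseteq> ?R"
  proof
    fix v assume "v \<in> ?L"
    then obtain k where k: "k \<noteq> 0" "eigenvector M_B v k" by blast
    from k(2,1) show "v \<in> ?R"
      by (rule M_B_eigenvector_cases) blast+
  qed
  show "?R \<subseteq> ?L"
  proof
    fix v assume "v \<in> ?R"
    then obtain c w where c: "c \<noteq> 0" and v: "v = c \<cdot>\<^sub>v w"
      and w: "w \<in> {beta_bar, tau_bar, gamma_bar, delta_bar}" by blast
    have M: "M_B \<in> carrier_mat 6 6" by (rule carrier_matI) (rule M_B_dim)+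
    have scaled: "v \<in> ?L" if "eigenvector M_B w k" "k \<noteq> 0" for k
    proof -
      have "eigenvector M_B v k"
        unfolding v by (rule eigenvector_smult[OF M that(1) c])
      with that(2) show ?thesis by blast
    qed
    from w consider "w = beta_bar" | "w = tau_bar" | "w = gamma_bar" | "w = delta_bar"
      by blast
    then show "v \<in> ?L"
    proof cases
      case 1 show ?thesis by (rule scaled[of "1/2"]) (simp_all add: 1 contrasts_eigenvectors)
    next
      case 2 show ?thesis by (rule scaled[of "3/16"]) (simp_all add: 2 contrasts_eigenvectors)
    next
      case 3 show ?thesis by (rule scaled[of "1/12"]) (simp_all add: 3 contrasts_eigenvectors)
    next
      case 4 show ?thesis by (rule scaled[of "1/6"]) (simp_all add: 4 contrasts_eigenvectors)
    qed
  qed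
qed

lemma contrasts_variances:
  "T_scaled_variance beta_bar = 1" "T_scaled_variance tau_bar = 1/4"
  "T_scaled_variance gamma_bar = 1/3" "T_scaled_variance delta_bar = 2/3"
  by (simp_all add: T_scaled_variance_def M_B_contrasts contrasts_gram)

theorem proposition2:
  shows "eigenvector M_B beta_bar (1/2)
       \<and> eigenvector M_B tau_bar (3/16)
       \<and> eigenvector M_B gamma_bar (1/12)
       \<and> eigenvector M_B delta_bar (1/6)
       \<and> {k. eigenvalue M_B k \<and> k \<noteq> 0} = {1/2, 3/16, 1/12, 1/6}
       \<and> {v. \<exists>k. k \<noteq> 0 \<and> eigenvector M_B v k} =
           {c \<cdot>\<^sub>v w | c w. c \<noteq> 0 \<and> w \<in> {beta_bar, tau_bar, gamma_bar, delta_bar}}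
       \<and> T_scaled_variance beta_bar = 1
       \<and> T_scaled_variance tau_bar = 1/4
       \<and> T_scaled_variance gamma_bar = 1/3
       \<and> T_scaled_variance delta_bar = 2/3"
  by (intro conjI contrasts_eigenvectors M_B_nonzero_eigenvalues M_B_nonzero_eigenvectors
      contrasts_variances)

end
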